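(* Let $\Sigma = S_1 \ast \dots \ast S_n$ be a spatial conjunction. Then $\Sigma$ is satisfiable (i.e. there exist a stack $s$ and a heap $h$ with $s,h \models \Sigma$) if, and only if, the pure formula $\mathrm{WellFormed}(\Sigma)$ is satisfiable (i.e. there exists a stack $s$ with $s(\mathrm{WellFormed}(\Sigma)) = \top$).
   Context: Setting: a many-sorted first-order language whose sorts include $\mathsf{Int}$ (integers) and $\mathsf{Bool}$, with built-in equality $\simeq$, the boolean connectives and quantifiers, and possibly further theory symbols (e.g. arithmetic) with their standard interpretations. Variables are uninterpreted constant symbols. A formula or expression is pure if it contains no spatial symbol. A stack is a function $s$ mapping each variable to a value of its sort; it is extended to all pure expressions by the standard interpretation of theory symbols. A heap is a partial function $h\colon \mathbb{Z} \rightharpoonup \mathsf{Val}$ (where $\mathsf{Val}$ is the disjoint union of the value sets of all sorts). For heaps $h_1,\dots,h_n$, writing $h = h_1 \ast \dots \ast h_n$ means $h$ is their union and their domains are pairwise disjoint. Spatial predicates are $\mathrm{emp}$, $\mathrm{next}(x,y)$ and $\mathrm{lseg}(x,y)$ with $x,y$ pure expressions of sort $\mathsf{Int}$. A spatial conjunction $\Sigma = S_1 \ast \dots \ast S_n$ ($n \ge 0$) of spatial predicates is treated as a finite multiset of spatial predicates. Semantics: $s,h \models \Pi$ for pure $\Pi$ iff $s(\Pi)=\top$; $s,h\models \mathrm{emp}$ iff $h=\emptyset$; $s,h \models \mathrm{next}(x,y)$ iff $h = \{s(x)\mapsto s(y)\}$; $s,h \models F_1 \ast F_2$ iff $h = h_1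 \ast h_2$ for some $h_1,h_2$ with $s,h_1\models F_1$ and $s,h_2\models F_2$ (the empty spatial conjunction means $\mathrm{emp}$); $\mathrm{lseg}$ is given by the inductive definition $\mathrm{lseg}(x,z) \equiv (x\simeq z \land \mathrm{emp}) \lor (x \not\simeq z \land \exists y.\, \mathrm{next}(x,y)\ast \mathrm{lseg}(y,z))$, i.e. $s,h\models\mathrm{lseg}(x,z)$ iff there are $n\ge 0$ and integers $a_0,\dots,a_n$ with $a_0=s(x)$, $a_n = s(z)$, $a_i \neq s(z)$ for $i<n$, and $h = \{a_0\mapsto a_1\} \ast \{a_1\mapsto a_2\}\ast\dots\ast\{a_{n-1}\mapsto a_n\}$. Boolean connectives are interpreted classically. Definitions: for a spatial predicate $S$, $\mathrm{Empty}(\mathrm{emp}) = \top$, $\mathrm{Empty}(\mathrm{next}(x,y)) = \bot$, $\mathrm{Empty}(\mathrm{lseg}(x,y)) = (x\simeq y)$; $\mathrm{Addr}(\mathrm{next}(x,y)) = \mathrm{Addr}(\mathrm{lseg}(x,y)) = x$ ($\mathrm{emp}$ has no address). $\mathrm{Collide}(S,S') = \lnot\mathrm{Empty}(S)\land\lnot\mathrm{Empty}(S')\land \mathrm{Addr}(S)\simeq\mathrm{Addr}(S')$ (which is $\bot$ if $S$ or $S'$ is $\mathrm{emp}$). For $\Sigma = S_1\ast\dots\ast S_n$, $\mathrm{WellFormed}(\Sigma) = \bigwedge_{1\le i<j\le n} \lnot\mathrm{Collide}(S_i,S_j)$. *)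

theory Defs
  imports "HOL-Library.Multiset"
begin

section \<open>The pure many-sorted language\<close>

datatype 'k srt = SInt | SBool | SOther 'k

text \<open>The tag \<open>'k\<close> in \<open>VOther\<close> makes the value sets of distinct sorts disjoint.\<close>

datatype ('k, 'u) val = VInt int | VBool bool | VOther 'k 'u

text \<open>A language consists of variables \<open>'x\<close>, theory symbols \<open>'f\<close> with their ranks and a fixed
  interpretation of these symbols, and a carrier for each sort other than \<open>SInt\<close> and \<open>SBool\<close>.
  Arithmetic is obtained by choosing \<open>'f\<close>, its ranks and \<open>interp\<close> accordingly.\<close>

record ('k, 'u, 'x, 'f) lang =
  var_sort :: "'x \<Rightarrow> 'k srt"
  arg_sorts :: "'f \<Rightarrow> 'k srt list"
  res_sort :: "'f \<Rightarrow> 'k srt"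
  carrier :: "'k \<Rightarrow> 'u set"
  interp :: "'f \<Rightarrow> ('k, 'u) val list \<Rightarrow> ('k, 'u) val"

fun vals :: "('k, 'u, 'x, 'f) lang \<Rightarrow> 'k srt \<Rightarrow> ('k, 'u) val set" where
  "vals L SInt = range VInt"
| "vals L SBool = range VBool"
| "vals L (SOther k) = VOther k ` carrier L k"

definition wf_lang :: "('k, 'u, 'x, 'f) lang \<Rightarrow> bool" where
  "wf_lang L \<longleftrightarrow>
     (\<forall>k. carrier L k \<noteq> {}) \<and>
     (\<forall>f vs. list_all2 (\<lambda>v k. v \<in> vals L k) vs (arg_sorts L f)
        \<longrightarrow> interp L f vs \<in> vals L (res_sort L f))"

text \<open>Pure formulas are the pure expressions of sort \<open>SBool\<close>.\<close>

datatype ('x, 'f) expr =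
    Var 'x
  | App 'f "('x, 'f) expr list"
  | Equal "('x, 'f) expr" "('x, 'f) expr"
  | Top
  | Bot
  | Neg "('x, 'f) expr"
  | Conj "('x, 'f) expr" "('x, 'f) expr"
  | Disj "('x, 'f) expr" "('x, 'f) expr"
  | Impl "('x, 'f) expr" "('x, 'f) expr"
  | Forall 'x "('x, 'f) expr"
  | Exists 'x "('x, 'f) expr"

inductive has_sort :: "('k, 'u, 'x, 'f) lang \<Rightarrow> ('x, 'f) expr \<Rightarrow> 'k srt \<Rightarrow> bool" for L where
  "has_sort L (Var x) (var_sort L x)"
| "list_all2 (has_sort L) ts (arg_sorts L f) \<Longrightarrow> has_sort L (App f ts) (res_sort L f)"
| "has_sort L t k \<Longrightarrow> has_sort L u k \<Longrightarrow> has_sort L (Equal t u) SBool"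
| "has_sort L Top SBool"
| "has_sort L Bot SBool"
| "has_sort L p SBool \<Longrightarrow> has_sort L (Neg p) SBool"
| "has_sort L p SBool \<Longrightarrow> has_sort L q SBool \<Longrightarrow> has_sort L (Conj p q) SBool"
| "has_sort L p SBool \<Longrightarrow> has_sort L q SBool \<Longrightarrow> has_sort L (Disj p q) SBool"
| "has_sort L p SBool \<Longrightarrow> has_sort L q SBool \<Longrightarrow> has_sort L (Impl p q) SBool"
| "has_sort L p SBool \<Longrightarrow> has_sort L (Forall x p) SBool"
| "has_sort L p SBool \<Longrightarrow> has_sort L (Exists x p) SBool"

definition is_stack :: "('k, 'u, 'x, 'f) lang \<Rightarrow> ('x \<Rightarrow> ('k, 'u) val) \<Rightarrow> bool" where
  "is_stack L s \<longleftrightarrow> (\<forall>x. s x \<in> vals L (var_sort L x))"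

fun eval :: "('k, 'u, 'x, 'f) lang \<Rightarrow> ('x \<Rightarrow> ('k, 'u) val) \<Rightarrow> ('x, 'f) expr \<Rightarrow> ('k, 'u) val" where
  "eval L s (Var x) = s x"
| "eval L s (App f ts) = interp L f (map (eval L s) ts)"
| "eval L s (Equal t u) = VBool (eval L s t = eval L s u)"
| "eval L s Top = VBool True"
| "eval L s Bot = VBool False"
| "eval L s (Neg p) = VBool (eval L s p \<noteq> VBool True)"
| "eval L s (Conj p q) = VBool (eval L s p = VBool True \<and> eval L s q = VBool True)"
| "eval L s (Disj p q) = VBool (eval L s p = VBool True \<or> eval L s q = VBool True)"
| "eval L s (Impl p q) = VBool (eval L s p = VBool True \<longrightarrow> eval L s q = VBool True)"
| "eval L s (Forall x p) =
     VBool (\<forall>v \<in> vals L (var_sort L x). eval L (s(x := v)) p = VBool True)"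
| "eval L s (Exists x p) =
     VBool (\<exists>v \<in> vals L (var_sort L x). eval L (s(x := v)) p = VBool True)"

definition pure_satisfiable :: "('k, 'u, 'x, 'f) lang \<Rightarrow> ('x, 'f) expr \<Rightarrow> bool" where
  "pure_satisfiable L p \<longleftrightarrow> (\<exists>s. is_stack L s \<and> eval L s p = VBool True)"


section \<open>Heaps and spatial conjunctions\<close>

type_synonym ('k, 'u) heap = "int \<rightharpoonup> ('k, 'u) val"

definition is_heap :: "('k, 'u, 'x, 'f) lang \<Rightarrow> ('k, 'u) heap \<Rightarrow> bool" where
  "is_heap L h \<longleftrightarrow> ran h \<subseteq> (\<Union>k. vals L k)"

definition splits :: "('k, 'u) heap \<Rightarrow> ('k, 'u) heap \<Rightarrow> ('k, 'u) heap \<Rightarrow> bool" where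
  "splits h h1 h2 \<longleftrightarrow> dom h1 \<inter> dom h2 = {} \<and> h = h1 ++ h2"

datatype ('x, 'f) spatial =
    Emp
  | Next "('x, 'f) expr" "('x, 'f) expr"
  | Lseg "('x, 'f) expr" "('x, 'f) expr"

fun wf_spatial :: "('k, 'u, 'x, 'f) lang \<Rightarrow> ('x, 'f) spatial \<Rightarrow> bool" where
  "wf_spatial L Emp \<longleftrightarrow> True"
| "wf_spatial L (Next x y) \<longleftrightarrow> has_sort L x SInt \<and> has_sort L y SInt"
| "wf_spatial L (Lseg x y) \<longleftrightarrow> has_sort L x SInt \<and> has_sort L y SInt"

inductive lseg :: "int \<Rightarrow> int \<Rightarrow> ('k, 'u) heap \<Rightarrow> bool" where
  "lseg a a Map.empty"
| "a \<noteq> c \<Longrightarrow> lseg b c h' \<Longrightarrow> splits h [a \<mapsto> VInt b] h' \<Longrightarrow> lseg a c h"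

fun sat1 :: "('k, 'u, 'x, 'f) lang \<Rightarrow> ('x \<Rightarrow> ('k, 'u) val) \<Rightarrow> ('k, 'u) heap
    \<Rightarrow> ('x, 'f) spatial \<Rightarrow> bool" where
  "sat1 L s h Emp \<longleftrightarrow> h = Map.empty"
| "sat1 L s h (Next x y) \<longleftrightarrow>
     (\<exists>a b. eval L s x = VInt a \<and> eval L s y = VInt b \<and> h = [a \<mapsto> VInt b])"
| "sat1 L s h (Lseg x y) \<longleftrightarrow>
     (\<exists>a b. eval L s x = VInt a \<and> eval L s y = VInt b \<and> lseg a b h)"

text \<open>A spatial conjunction is given by an enumeration \<open>[S\<^sub>1, \<dots>, S\<^sub>n]\<close> of its multiset of conjuncts,
  because the formula \<open>well_formed\<close> below refers to the indices. Lemma \<open>sat_mset_cong\<close> shows that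
  satisfaction depends on the multiset only.\<close>

fun sat :: "('k, 'u, 'x, 'f) lang \<Rightarrow> ('x \<Rightarrow> ('k, 'u) val) \<Rightarrow> ('k, 'u) heap
    \<Rightarrow> ('x, 'f) spatial list \<Rightarrow> bool" where
  "sat L s h [] \<longleftrightarrow> h = Map.empty"
| "sat L s h (S # Ss) \<longleftrightarrow> (\<exists>h1 h2. splits h h1 h2 \<and> sat1 L s h1 S \<and> sat L s h2 Ss)"

definition spatial_satisfiable ::
    "('k, 'u, 'x, 'f) lang \<Rightarrow> ('x, 'f) spatial list \<Rightarrow> bool" where
  "spatial_satisfiable L Ss \<longleftrightarrow> (\<exists>s h. is_stack L s \<and> is_heap L h \<and> sat L s h Ss)"

lemma splits_exchange:
  assumes "splits h h1 g" "splits g h2 h3"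
  shows "\<exists>g'. splits h h2 g' \<and> splits g' h1 h3"
proof (intro exI conjI)
  show "splits (h1 ++ h3) h1 h3"
    using assms by (auto simp: splits_def)
  have "h1 ++ h2 = h2 ++ h1"
    using assms by (intro map_add_comm) (auto simp: splits_def)
  then show "splits h h2 (h1 ++ h3)"
    using assms by (auto simp: splits_def)
qed

lemma sat_insert_mid: "sat L s h (Ss @ S # Ts) \<longleftrightarrow> sat L s h (S # Ss @ Ts)"
proof (induction Ss arbitrary: h)
  case (Cons R Ss)
  then show ?case
    by simp (meson splits_exchange)
qed simp

lemma sat_mset_cong: "mset Ss = mset Ts \<Longrightarrow> sat L s h Ss \<longleftrightarrow> sat L s h Ts"
proof (induction Ss arbitrary: Ts h)
  case (Cons S Ss)
  then obtain As Bs where Ts: "Ts = As @ S # Bs"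
    by (metis list.set_intros(1) mset_eq_setD split_list)
  with Cons.prems have "mset Ss = mset (As @ Bs)"
    by simp
  then show ?case
    unfolding Ts sat_insert_mid using Cons.IH by (simp only: sat.simps)
qed simp


section \<open>Well-formedness\<close>

fun empty :: "('x, 'f) spatial \<Rightarrow> ('x, 'f) expr" where
  "empty Emp = Top"
| "empty (Next x y) = Bot"
| "empty (Lseg x y) = Equal x y"

fun addr :: "('x, 'f) spatial \<Rightarrow> ('x, 'f) expr option" where
  "addr Emp = None"
| "addr (Next x y) = Some x"
| "addr (Lseg x y) = Some x"

definition collide :: "('x, 'f) spatial \<Rightarrow> ('x, 'f) spatial \<Rightarrow> ('x, 'f) expr" where
  "collide S S' = (case (addr S, addr S') of
       (Some x, Some x') \<Rightarrow> Conj (Neg (empty S)) (Conj (Neg (empty S')) (Equal x x'))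
     | _ \<Rightarrow> Bot)"

definition well_formed :: "('x, 'f) spatial list \<Rightarrow> ('x, 'f) expr" where
  "well_formed Ss =
     foldr Conj [Neg (collide (Ss ! i) (Ss ! j)). j \<leftarrow> [0..<length Ss], i \<leftarrow> [0..<j]] Top"

lemma has_sort_well_formed:
  assumes "\<forall>S \<in> set Ss. wf_spatial L S"
  shows "has_sort L (well_formed Ss) SBool"
proof -
  have addr: "has_sort L x SInt" if "addr S = Some x" "wf_spatial L S" for S x
    using that by (cases S) auto
  have empty: "has_sort L (empty S) SBool" if "wf_spatial L S" for S
    using that by (cases S) (auto intro: has_sort.intros)
  have collide: "has_sort L (collide S S') SBool" if "wf_spatial L S" "wf_spatial L S'" for S S'
    using that by (auto simp: collide_def split: option.split intro!: has_sort.intros addr empty)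
  have conj: "has_sort L (foldr Conj ps Top) SBool" if "\<forall>p \<in> set ps. has_sort L p SBool" for ps
    using that by (induction ps) (auto intro: has_sort.intros)
  show ?thesis
    unfolding well_formed_def using assms
    by (intro conj) (auto intro!: has_sort.intros collide)
qed

end

(* The same stack serves both directions.  In any model of Ss, a nonempty conjunct owns the cell at
   its address, so two conjuncts cannot collide.  Conversely, given a stack without collisions, realise
   every nonempty conjunct, list segments included, by a single cell from its address to its target. *)
theory Submission
  imports Defs
begin

lemma eval_has_sort:
  assumes "has_sort L t k" "wf_lang L" "is_stack L s"
  shows "eval L s t \<in> vals L k"
  using assms
proof (induction rule: has_sort.induct)
  case (1 x)
  then show ?case by (simp add: is_stack_def)
next
  case (2 ts f)
  then have "list_all2 (\<lambda>v k. v \<in> vals L k) (map (eval L s) ts) (arg_sorts L f)"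
    by (auto simp: list_all2_conv_all_nth)
  with \<open>wf_lang L\<close> show ?case by (simp add: wf_lang_def)
qed auto

text \<open>At most one element: the address that every model of \<open>S\<close> must allocate.
  Empty conjuncts, \<open>Emp\<close> included, get \<open>{}\<close>, so absence of a collision
  becomes disjointness.\<close>

definition alloc :: "('k, 'u, 'x, 'f) lang \<Rightarrow> ('x \<Rightarrow> ('k, 'u) val) \<Rightarrow> ('x, 'f) spatial \<Rightarrow> int set" where
  "alloc L s S =
     {a. \<exists>x. addr S = Some x \<and> eval L s x = VInt a \<and> eval L s (empty S) \<noteq> VBool True}"

text \<open>Well-sortedness makes the address of \<open>S\<close> an integer; a non-integer address
  could collide while \<open>alloc\<close> is \<open>{}\<close>. Sorting one side suffices, since a
  collision equates both addresses.\<close>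

lemma eval_Neg_collide:
  assumes "wf_lang L" "is_stack L s" "wf_spatial L S"
  shows "eval L s (Neg (collide S S')) = VBool True \<longleftrightarrow> alloc L s S \<inter> alloc L s S' = {}"
proof -
  show ?thesis
  proof (cases "addr S")
    case None
    then show ?thesis by (simp add: collide_def alloc_def)
  next
    case (Some x)
    with assms(3) have "has_sort L x SInt"
      by (cases S) auto
    from eval_has_sort[OF this assms(1,2)] obtain a where "eval L s x = VInt a"
      by auto
    with Some show ?thesis
      by (cases "addr S'") (auto simp: collide_def alloc_def)
  qed
qed

lemma eval_foldr_Conj:
  "eval L s (foldr Conj ps Top) = VBool True \<longleftrightarrow> (\<forall>p \<in> set ps. eval L s p = VBool True)"
  by (induction ps) auto

text \<open>Trades index pairs for a predicate that unfolds along \<open>#\<close>, as the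
  inductions over \<open>Ss\<close> in both directions require.\<close>

lemma eval_well_formed:
  assumes "wf_lang L" "is_stack L s" "\<forall>S \<in> set Ss. wf_spatial L S"
  shows "eval L s (well_formed Ss) = VBool True \<longleftrightarrow>
    sorted_wrt (\<lambda>S S'. alloc L s S \<inter> alloc L s S' = {}) Ss"
proof -
  have "eval L s (well_formed Ss) = VBool True \<longleftrightarrow>
      (\<forall>j<length Ss. \<forall>i<j. eval L s (Neg (collide (Ss ! i) (Ss ! j))) = VBool True)"
    \<comment> \<open>The negated collisions must stay folded for \<open>eval_Neg_collide\<close> to
      apply next.\<close>
    unfolding well_formed_def eval_foldr_Conj by (auto simp del: eval.simps)
  also have "\<dots> \<longleftrightarrow> (\<forall>j<length Ss. \<forall>i<j. alloc L s (Ss ! i) \<inter> alloc L s (Ss ! j) = {})"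
    by (intro all_cong1 imp_cong refl eval_Neg_collide[OF assms(1,2)]) (use assms(3) in auto)
  finally show ?thesis
    by (auto simp: sorted_wrt_iff_nth_less)
qed

lemma sat1_alloc_subset_dom:
  assumes "sat1 L s h S"
  shows "alloc L s S \<subseteq> dom h"
proof (cases S)
  case (Lseg x y)
  with assms obtain a b where ab: "eval L s x = VInt a" "eval L s y = VInt b" "lseg a b h"
    by auto
  \<comment> \<open>Inversion of \<open>lseg\<close>: the first rule forces equal ends, the second
    puts a cell at \<open>a\<close>.\<close>
  from ab(3) have "a = b \<or> a \<in> dom h"
    by cases (auto simp: splits_def)
  with ab(1,2) Lseg show ?thesis by (auto simp: alloc_def)
qed (use assms in \<open>auto simp: alloc_def\<close>)

lemma sat_alloc_subset_dom:
  "sat L s h Ss \<Longrightarrow> S \<in> set Ss \<Longrightarrow> alloc L s S \<subseteq> dom h"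
proof (induction Ss arbitrary: h)
  case (Cons T Ss)
  then obtain h1 h2 where h: "splits h h1 h2" "sat1 L s h1 T" "sat L s h2 Ss"
    by auto
  then have "dom h = dom h1 \<union> dom h2"
    by (auto simp: splits_def)
  with Cons.IH[OF h(3)] Cons.prems(2) sat1_alloc_subset_dom[OF h(2)] show ?case
    by auto
qed simp

text \<open>What the first conjunct must allocate lies in \<open>h1\<close>, what a later one must
  allocate lies in \<open>h2\<close>, and these domains are disjoint.\<close>

lemma sat_imp_alloc_disjoint:
  "sat L s h Ss \<Longrightarrow> sorted_wrt (\<lambda>S S'. alloc L s S \<inter> alloc L s S' = {}) Ss"
proof (induction Ss arbitrary: h)
  case (Cons S Ss)
  then obtain h1 h2 where h: "splits h h1 h2" "sat1 L s h1 S" "sat L s h2 Ss"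
    by auto
  have "alloc L s S \<inter> alloc L s S' = {}" if "S' \<in> set Ss" for S'
    using sat1_alloc_subset_dom[OF h(2)] sat_alloc_subset_dom[OF h(3) that] h(1)
    unfolding splits_def by blast
  with Cons.IH[OF h(3)] show ?case by simp
qed simp

text \<open>With a direct link there are no intermediate cells that could clash with other
  conjuncts.\<close>

lemma lseg_single: "a \<noteq> b \<Longrightarrow> lseg a b [a \<mapsto> VInt b]"
  by (rule lseg.intros(2)[OF _ lseg.intros(1)]) (auto simp: splits_def)

text \<open>The lower bound of \<open>sat1_alloc_subset_dom\<close> is attained.\<close>

lemma ex_sat1_dom_alloc:
  assumes "wf_lang L" "is_stack L s" "wf_spatial L S"
  shows "\<exists>h. sat1 L s h S \<and> dom h = alloc L s S \<and> ran h \<subseteq> range VInt"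
proof (cases S)
  case Emp
  then show ?thesis by (auto simp: alloc_def)
next
  case (Next x y)
  with assms eval_has_sort[of L _ SInt s] obtain a b
    where "eval L s x = VInt a" "eval L s y = VInt b" by fastforce
  with Next show ?thesis
    by (intro exI[of _ "[a \<mapsto> VInt b]"]) (auto simp: alloc_def)
next
  case (Lseg x y)
  with assms eval_has_sort[of L _ SInt s] obtain a b
    where "eval L s x = VInt a" "eval L s y = VInt b" by fastforce
  with Lseg show ?thesis
    \<comment> \<open>A cell is allowed only for distinct ends, since the second rule of
      \<open>lseg\<close> demands \<open>a \<noteq> c\<close>.\<close>
    by (intro exI[of _ "if a = b then Map.empty else [a \<mapsto> VInt b]"])
      (auto simp: alloc_def lseg.intros(1) lseg_single)
qed

text \<open>The exact domain carries the induction: disjoint \<open>alloc\<close> sets let the heap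
  of the head be joined to that of the tail.\<close>

lemma ex_sat_dom_alloc:
  assumes "wf_lang L" "is_stack L s" "\<forall>S \<in> set Ss. wf_spatial L S"
    and "sorted_wrt (\<lambda>S S'. alloc L s S \<inter> alloc L s S' = {}) Ss"
  shows "\<exists>h. sat L s h Ss \<and> dom h = (\<Union>S \<in> set Ss. alloc L s S) \<and> ran h \<subseteq> range VInt"
  using assms(3,4)
proof (induction Ss)
  case (Cons S Ss)
  then obtain h2 where h2: "sat L s h2 Ss" "dom h2 = (\<Union>S \<in> set Ss. alloc L s S)"
      "ran h2 \<subseteq> range VInt"
    by auto
  obtain h1 where h1: "sat1 L s h1 S" "dom h1 = alloc L s S" "ran h1 \<subseteq> range VInt"
    using ex_sat1_dom_alloc[OF assms(1,2)] Cons.prems(1) by (meson list.set_intros(1))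
  have disj: "dom h1 \<inter> dom h2 = {}"
    using Cons.prems(2) h1(2) h2(2) by auto
  then have "splits (h1 ++ h2) h1 h2"
    by (simp add: splits_def)
  moreover have "ran (h1 ++ h2) \<subseteq> range VInt"
    using ran_map_add[OF disj] h1(3) h2(3) by simp
  moreover have "dom (h1 ++ h2) = (\<Union>S \<in> set (S # Ss). alloc L s S)"
    using h1(2) h2(2) by auto
  ultimately show ?case
    using h1(1) h2(1) by (meson sat.simps(2))
qed simp

theorem theorem1:
  fixes L :: "('k, 'u, 'x, 'f) lang"
    and Ss :: "('x, 'f) spatial list"
  assumes "wf_lang L"
    and "\<forall>S \<in> set Ss. wf_spatial L S"
  shows "spatial_satisfiable L Ss \<longleftrightarrow> pure_satisfiable L (well_formed Ss)"
proof
  assume "spatial_satisfiable L Ss"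
  then show "pure_satisfiable L (well_formed Ss)"
    unfolding spatial_satisfiable_def pure_satisfiable_def
    using eval_well_formed[OF assms(1) _ assms(2)] sat_imp_alloc_disjoint by blast
next
  assume "pure_satisfiable L (well_formed Ss)"
  then obtain s where s: "is_stack L s" "eval L s (well_formed Ss) = VBool True"
    unfolding pure_satisfiable_def by blast
  obtain h where h: "sat L s h Ss" "ran h \<subseteq> range VInt"
    using ex_sat_dom_alloc[OF assms(1) s(1) assms(2)] eval_well_formed[OF assms(1) s(1) assms(2)] s(2)
    by blast
  \<comment> \<open>The constructed heap stores only integers, which are values of sort
    \<open>SInt\<close>.\<close>
  have "range VInt \<subseteq> (\<Union>k. vals L k)"
    by (metis UNIV_I UN_upper vals.simps(1))
  with h(2) have "is_heap L h"
    unfolding is_heap_def by (rule subset_trans)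
  with s(1) h(1) show "spatial_satisfiable L Ss"
    unfolding spatial_satisfiable_def by blast
qed

end
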